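(* Let $r \ge 2$ be an integer. Then the free semigroup $FS_r$ of rank $r$ has subsemigroup growth of strict type $n^n$; that is, $\log(s_n(FS_r)) \asymp \log(n^n)$ as $n \to \infty$.
   Context: $FS_r = X_r^+$ is the free semigroup on $r$ generators $X_r=\{g_1,\dots,g_r\}$, i.e. all non-empty words over $X_r$ under concatenation. The (Rees) index of a subsemigroup $T$ of a semigroup $S$ is $|S\setminus T|$. For a finitely generated semigroup $S$, $a_n(S)$ denotes the number of subsemigroups of $S$ of Rees index exactly $n$ (this is finite), and $s_n(S)=\sum_{i=1}^n a_i(S)$. For sequences, $f(n)=O(g(n))$ means there is a constant $C>0$ with $f(n)\le C\,g(n)$ for all large $n$, and $f(n)\asymp g(n)$ means $f(n)=O(g(n))$ and $g(n)=O(f(n))$. $S$ has subsemigroup growth of strict type $f(n)$ if $\log(s_n(S))\asymp\log(f(n))$. $\log$ is base $2$. *)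

theory Defs
  imports Complex_Main "HOL-Library.Landau_Symbols"
begin

text \<open>A semigroup is given by its carrier and its multiplication.\<close>

definition subsemigroup :: "'a set \<Rightarrow> ('a \<Rightarrow> 'a \<Rightarrow> 'a) \<Rightarrow> 'a set \<Rightarrow> bool" where
  "subsemigroup S m T \<longleftrightarrow> T \<subseteq> S \<and> T \<noteq> {} \<and> (\<forall>x\<in>T. \<forall>y\<in>T. m x y \<in> T)"

text \<open>Finiteness of the complement is required explicitly because \<^term>\<open>card\<close> of an
  infinite set is \<open>0\<close>.\<close>

definition subsemigroups_of_index ::
  "'a set \<Rightarrow> ('a \<Rightarrow> 'a \<Rightarrow> 'a) \<Rightarrow> nat \<Rightarrow> 'a set set" where
  "subsemigroups_of_index S m n =
     {T. subsemigroup S m T \<and> finite (S - T) \<and> card (S - T) = n}"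

text \<open>The count is meaningful for finitely generated semigroups, which have only finitely many
  subsemigroups of each finite index.\<close>

definition num_index :: "'a set \<Rightarrow> ('a \<Rightarrow> 'a \<Rightarrow> 'a) \<Rightarrow> nat \<Rightarrow> nat" where
  "num_index S m n = card (subsemigroups_of_index S m n)"

definition subsemigroup_growth :: "'a set \<Rightarrow> ('a \<Rightarrow> 'a \<Rightarrow> 'a) \<Rightarrow> nat \<Rightarrow> nat" where
  "subsemigroup_growth S m n = (\<Sum>i=1..n. num_index S m i)"

definition has_growth_of_strict_type ::
  "'a set \<Rightarrow> ('a \<Rightarrow> 'a \<Rightarrow> 'a) \<Rightarrow> (nat \<Rightarrow> real) \<Rightarrow> bool" where
  "has_growth_of_strict_type S m f \<longleftrightarrow>
     (\<lambda>n. log 2 (real (subsemigroup_growth S m n))) \<in> \<Theta>(\<lambda>n. log 2 (f n))"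

text \<open>Non-empty words over the alphabet \<open>{0, \<dots>, r - 1}\<close>; the multiplication is \<^term>\<open>(@)\<close>.\<close>

definition free_semigroup :: "nat \<Rightarrow> nat list set" where
  "free_semigroup r = {w. w \<noteq> [] \<and> set w \<subseteq> {..<r}}"

end

theory Submission
  imports Defs
begin

text \<open>Upper bound: let \<open>W\<close> be the complement of a subsemigroup \<open>T\<close>. In every factorisation
  \<open>w = u v\<close> of a word of \<open>W\<close>, one of \<open>u\<close>, \<open>v\<close> lies in \<open>W\<close>. Moving the cut through \<open>w\<close>, one finds
  \<open>w = a g b\<close>, where \<open>a\<close> and \<open>b\<close> are empty or in \<open>W\<close> and \<open>g\<close> is empty or a letter. Listing
  \<open>W\<close> by increasing length, every word is therefore one of at most \<open>(r + 1) n\<^sup>2\<close> combinations of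
  its predecessors, so there are at most \<open>((r + 1) n\<^sup>2)\<^sup>n\<close> complements of size \<open>n\<close>.

  Lower bound: choose \<open>k\<close> with \<open>r\<^sup>k\<close> about \<open>n/2\<close>. Removing any set of words of length \<open>2 k - 1\<close> from
  the words of length at least \<open>k\<close> leaves a subsemigroup. There are about \<open>n\<^sup>2\<close> words of length
  \<open>2 k - 1\<close>, and at least \<open>n/2\<close> of them are to be removed to reach index \<open>n\<close>.\<close>

section \<open>Upper bound: counting complements\<close>

lemma complement_factorisation:
  assumes T: "subsemigroup (free_semigroup r) (@) T" and w: "w \<in> free_semigroup r - T"
  obtains a g b where "w = a @ g @ b"
    "a \<in> insert [] {v \<in> free_semigroup r - T. length v < length w}"
    "b \<in> insert [] {v \<in> free_semigroup r - T. length v < length w}"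
    "g \<in> insert [] ((\<lambda>x. [x]) ` {..<r})"
proof -
  let ?W = "free_semigroup r - T"
  let ?m = "length w"
  have split: "take i w \<in> ?W \<or> drop i w \<in> ?W" if "0 < i" "i < ?m" for i
  proof (rule ccontr)
    assume "\<not> ?thesis"
    moreover have "take i w \<in> free_semigroup r" "drop i w \<in> free_semigroup r"
      using that w set_take_subset[of i w] set_drop_subset[of i w]
      by (auto simp: free_semigroup_def)
    ultimately have "take i w @ drop i w \<in> T"
      using T unfolding subsemigroup_def by blast
    with w show False by simp
  qed
  \<comment> \<open>\<open>Q i\<close> holds when the suffix from \<open>i\<close> on is empty or a
    proper suffix outside \<open>T\<close>. With \<open>Suc j\<close> the least positive such
    position, either \<open>j\<close> is 0 and the prefix before the letter is empty, or
    \<open>Q j\<close> fails and \<open>split\<close> puts that prefix outside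
    \<open>T\<close>.\<close>
  define Q where "Q i \<longleftrightarrow> i = ?m \<or> (0 < i \<and> i < ?m \<and> drop i w \<in> ?W)" for i
  define j where "j = (LEAST i. Q (Suc i))"
  have m: "?m > 0" using w by (auto simp: free_semigroup_def)
  have ex: "Q (Suc (?m - 1))" using m by (simp add: Q_def)
  have Qj: "Q (Suc j)" unfolding j_def by (rule LeastI[of "\<lambda>i. Q (Suc i)", OF ex])
  have j: "j < ?m" using Qj by (auto simp: Q_def)
  have "take j w \<in> insert [] {v \<in> ?W. length v < ?m}"
  proof (cases j)
    case (Suc i)
    have "\<not> Q j"
      using not_less_Least[of i "\<lambda>i. Q (Suc i)"] Suc j_def by simp
    then show ?thesis using split[of j] Suc j by (auto simp: Q_def)
  qed simp
  moreover have "drop (Suc j) w \<in> insert [] {v \<in> ?W. length v < ?m}"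
    using Qj by (auto simp: Q_def)
  moreover have "[w ! j] \<in> insert [] ((\<lambda>x. [x]) ` {..<r})"
    using w nth_mem[OF j] by (auto simp: free_semigroup_def simp del: nth_mem)
  moreover have "w = take j w @ [w ! j] @ drop (Suc j) w"
    using id_take_nth_drop[OF j] by simp
  ultimately show thesis using that by blast
qed

text \<open>Over-approximates the complements of size \<open>n\<close>: closure and word lengths are
  forgotten and only the order of insertion is kept, which suffices for counting. An inserted word
  may already be present, so members can have fewer than \<open>n\<close> elements.\<close>

primrec built_sets :: "nat \<Rightarrow> nat \<Rightarrow> nat list set set" where
  "built_sets r 0 = {{}}"
| "built_sets r (Suc n) = (\<Union>V\<in>built_sets r n.
     (\<lambda>(a, g, b). insert (a @ g @ b) V) `
       (insert [] V \<times> insert [] ((\<lambda>x. [x]) ` {..<r}) \<times> insert [] V))"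

lemma built_sets_elem:
  "V \<in> built_sets r n \<Longrightarrow> finite V \<and> card V \<le> n"
  by (induction n arbitrary: V) (auto simp: card_insert_if le_SucI)

text \<open>A set of at most \<open>n\<close> words offers \<open>n + 1\<close> choices for each
  outer factor, counting the empty word, and \<open>r + 1\<close> for the middle one. The number of
  choices at the last stage dominates all earlier ones.\<close>

lemma card_built_sets:
  "finite (built_sets r n) \<and> card (built_sets r n) \<le> ((r + 1) * n\<^sup>2) ^ n"
proof (induction n)
  case (Suc n)
  let ?A = "\<lambda>V. insert [] V \<times> insert [] ((\<lambda>x. [x]) ` {..<r}) \<times> insert ([] :: nat list) V"
  have A: "finite (?A V) \<and> card (?A V) \<le> (r + 1) * (Suc n)\<^sup>2" if "V \<in> built_sets r n" for V
  proof -
    have V: "finite V" "card V \<le> n" using built_sets_elem[OF that] by auto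
    have "card (insert [] V) \<le> Suc n" using V by (simp add: card_insert_if)
    moreover have "card (insert [] ((\<lambda>x. [x]) ` {..<r})) \<le> r + 1"
      using card_image_le[of "{..<r}" "\<lambda>x. [x]"] by (simp add: card_insert_if)
    ultimately have "card (?A V) \<le> Suc n * ((r + 1) * Suc n)"
      unfolding card_cartesian_product by (intro mult_le_mono)
    then show ?thesis using V by (simp add: power2_eq_square algebra_simps)
  qed
  have fin: "finite (built_sets r (Suc n))" using Suc A by auto
  have "card (built_sets r (Suc n)) \<le>
      (\<Sum>V\<in>built_sets r n. card ((\<lambda>(a, g, b). insert (a @ g @ b) V) ` ?A V))"
    unfolding built_sets.simps using Suc by (intro card_UN_le) auto
  also have "\<dots> \<le> (\<Sum>V\<in>built_sets r n. (r + 1) * (Suc n)\<^sup>2)"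
    using A by (intro sum_mono) (meson card_image_le order_trans)
  also have "\<dots> = card (built_sets r n) * ((r + 1) * (Suc n)\<^sup>2)" by simp
  also have "\<dots> \<le> ((r + 1) * (Suc n)\<^sup>2) ^ n * ((r + 1) * (Suc n)\<^sup>2)"
  proof (rule mult_le_mono1)
    have "card (built_sets r n) \<le> ((r + 1) * n\<^sup>2) ^ n" using Suc by blast
    also have "\<dots> \<le> ((r + 1) * (Suc n)\<^sup>2) ^ n"
      by (intro power_mono mult_le_mono) auto
    finally show "card (built_sets r n) \<le> ((r + 1) * (Suc n)\<^sup>2) ^ n" .
  qed
  finally show ?case using fin by (simp add: mult.commute)
qed simp

text \<open>The induction removes a longest word \<open>w\<close>. Factors are strictly shorter than
  the word they build, so \<open>w\<close> is a factor of no word of \<open>W\<close>, and the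
  factorisations of the others survive in \<open>V\<close>.\<close>

lemma built_setsI:
  assumes "finite W" "card W = n"
    and "\<And>w. w \<in> W \<Longrightarrow> \<exists>a\<in>insert [] {v \<in> W. length v < length w}.
           \<exists>g\<in>insert [] ((\<lambda>x. [x]) ` {..<r}).
           \<exists>b\<in>insert [] {v \<in> W. length v < length w}. w = a @ g @ b"
  shows "W \<in> built_sets r n"
  using assms
proof (induction n arbitrary: W)
  case (Suc n)
  have "W \<noteq> {}" using Suc.prems by auto
  then have "Max (length ` W) \<in> length ` W" using Suc.prems(1) by simp
  then obtain w where "w \<in> W" "length w = Max (length ` W)" by auto
  then have w: "w \<in> W" "\<And>v. v \<in> W \<Longrightarrow> length v \<le> length w"
    using Suc.prems(1) by auto
  define V where "V = W - {w}"
  have smaller: "{v \<in> W. length v < length u} \<subseteq> V" if "u \<in> W" for u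
    using w(2)[OF that] by (auto simp: V_def)
  have "V \<in> built_sets r n"
  proof (rule Suc.IH)
    show "finite V" "card V = n" using Suc.prems w by (auto simp: V_def)
    fix u assume "u \<in> V"
    then have u: "u \<in> W" by (simp add: V_def)
    then have "{v \<in> W. length v < length u} \<subseteq> {v \<in> V. length v < length u}"
      using smaller by blast
    then show "\<exists>a\<in>insert [] {v \<in> V. length v < length u}.
           \<exists>g\<in>insert [] ((\<lambda>x. [x]) ` {..<r}).
           \<exists>b\<in>insert [] {v \<in> V. length v < length u}. u = a @ g @ b"
      using Suc.prems(3)[OF u] by blast
  qed
  moreover obtain a g b where "a \<in> insert [] V" "b \<in> insert [] V"
      "g \<in> insert [] ((\<lambda>x. [x]) ` {..<r})" "w = a @ g @ b"
    using Suc.prems(3)[OF w(1)] smaller[OF w(1)] by blast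
  moreover have "W = insert w V" using w by (auto simp: V_def)
  ultimately have "W \<in> (\<lambda>(a, g, b). insert (a @ g @ b) V) `
       (insert [] V \<times> insert [] ((\<lambda>x. [x]) ` {..<r}) \<times> insert [] V)"
    by (intro image_eqI[of _ _ "(a, g, b)"]) auto
  with \<open>V \<in> built_sets r n\<close> show ?case unfolding built_sets.simps by blast
qed simp

lemma subsemigroups_of_index_built:
  "subsemigroups_of_index (free_semigroup r) (@) n \<subseteq> (\<lambda>W. free_semigroup r - W) ` built_sets r n"
proof
  fix T assume "T \<in> subsemigroups_of_index (free_semigroup r) (@) n"
  then have T: "subsemigroup (free_semigroup r) (@) T"
    "finite (free_semigroup r - T)" "card (free_semigroup r - T) = n"
    by (auto simp: subsemigroups_of_index_def)
  have "free_semigroup r - T \<in> built_sets r n"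
  proof (rule built_setsI[OF T(2,3)])
    fix w assume "w \<in> free_semigroup r - T"
    from complement_factorisation[OF T(1) this]
    show "\<exists>a\<in>insert [] {v \<in> free_semigroup r - T. length v < length w}.
           \<exists>g\<in>insert [] ((\<lambda>x. [x]) ` {..<r}).
           \<exists>b\<in>insert [] {v \<in> free_semigroup r - T. length v < length w}. w = a @ g @ b"
      by blast
  qed
  moreover have "T = free_semigroup r - (free_semigroup r - T)"
    using T(1) by (auto simp: subsemigroup_def)
  ultimately show "T \<in> (\<lambda>W. free_semigroup r - W) ` built_sets r n" by blast
qed

text \<open>An infinite family would have \<open>card\<close> 0; finiteness lets the injection in
  the lower bound yield a count.\<close>

lemma finite_subsemigroups_of_index:
  "finite (subsemigroups_of_index (free_semigroup r) (@) n)"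
  using subsemigroups_of_index_built card_built_sets by (meson finite_imageI finite_subset)

lemma num_index_upper: "num_index (free_semigroup r) (@) n \<le> ((r + 1) * n\<^sup>2) ^ n"
  using surj_card_le[OF _ subsemigroups_of_index_built] card_built_sets
  unfolding num_index_def by (meson order_trans)

lemma subsemigroup_growth_upper:
  "subsemigroup_growth (free_semigroup r) (@) n \<le> n * ((r + 1) * n\<^sup>2) ^ n"
proof -
  have "num_index (free_semigroup r) (@) i \<le> ((r + 1) * n\<^sup>2) ^ n" if "i \<in> {1..n}" for i
  proof -
    have "((r + 1) * i\<^sup>2) ^ i \<le> ((r + 1) * n\<^sup>2) ^ i"
      using that by (intro power_mono mult_le_mono) auto
    also have "\<dots> \<le> ((r + 1) * n\<^sup>2) ^ n"
      using that by (intro power_increasing) (auto simp: Suc_le_eq)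
    finally show ?thesis using num_index_upper order_trans by blast
  qed
  then have "subsemigroup_growth (free_semigroup r) (@) n \<le> of_nat (card {1..n}) * ((r + 1) * n\<^sup>2) ^ n"
    unfolding subsemigroup_growth_def by (rule sum_bounded_above)
  then show ?thesis by simp
qed

section \<open>Lower bound: removing words of one length\<close>

lemma sum_powers_le:
  assumes "r \<ge> (2 :: nat)"
  shows "(\<Sum>i\<le>l. r ^ i) \<le> r ^ Suc l"
proof (induction l)
  case (Suc l)
  have "(\<Sum>i\<le>Suc l. r ^ i) \<le> 2 * r ^ Suc l" using Suc by simp
  also have "\<dots> \<le> r * r ^ Suc l" using assms by (intro mult_le_mono1)
  finally show ?case by simp
qed (use assms in simp)

text \<open>A product of two words of length at least \<open>k\<close> has length at least
  \<open>2 * k\<close>, so it never meets a removed word. The count \<open>j\<close> is what remains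
  of the index \<open>n\<close> after the fewer than \<open>k\<close> letters long words in
  \<open>M\<close> are removed; these number at most \<open>r ^ k\<close>.\<close>

lemma num_index_lower:
  assumes "r \<ge> 2" "k \<ge> 1" "r ^ k \<le> n"
  obtains j where "n - r ^ k \<le> j" "j \<le> n"
    "r ^ (2 * k - 1) choose j \<le> num_index (free_semigroup r) (@) n"
proof -
  let ?S = "free_semigroup r"
  define M where "M = {w \<in> ?S. length w < k}"
  define B where "B = {w. set w \<subseteq> {..<r} \<and> length w = 2 * k - 1}"
  have BS: "B \<subseteq> ?S" using assms by (auto simp: B_def free_semigroup_def)
  have finB: "finite B" unfolding B_def by (rule finite_lists_length_eq) simp
  have cardB: "card B = r ^ (2 * k - 1)" unfolding B_def by (subst card_lists_length_eq) auto
  have M_sub: "M \<subseteq> {w. set w \<subseteq> {..<r} \<and> length w \<le> k - 1}"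
    by (auto simp: M_def free_semigroup_def)
  have finM: "finite M" using M_sub finite_lists_length_le[of "{..<r}"] finite_subset by blast
  have "card M \<le> card {w. set w \<subseteq> {..<r} \<and> length w \<le> k - 1}"
    by (rule card_mono[OF finite_lists_length_le M_sub]) simp
  also have "\<dots> = (\<Sum>i\<le>k - 1. r ^ i)" by (subst card_lists_length_le) auto
  also have "\<dots> \<le> r ^ Suc (k - 1)"
    using assms(1) by (rule sum_powers_le)
  finally have cardM: "card M \<le> r ^ k" using assms by simp
  have disj: "M \<inter> B = {}" using assms by (auto simp: M_def B_def)
  define j where "j = n - card M"
  define f where "f V = ?S - (M \<union> V)" for V
  have "f V \<in> subsemigroups_of_index ?S (@) n" if V: "V \<subseteq> B" "card V = j" for V
  proof -
    have fin: "finite V" using V finB finite_subset by blast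
    have "?S - f V = M \<union> V" using BS V by (auto simp: f_def M_def)
    moreover have "card (M \<union> V) = n"
      using finM fin disj V cardM assms by (subst card_Un_disjoint) (auto simp: j_def)
    \<comment> \<open>This witness of non-emptiness is longer than every removed word.\<close>
    moreover have "replicate (2 * k) 0 \<in> f V"
      using assms V by (auto simp: f_def M_def B_def free_semigroup_def)
    moreover have "x @ y \<in> f V" if "x \<in> f V" "y \<in> f V" for x y
      using that assms V by (auto simp: f_def M_def B_def free_semigroup_def)
    ultimately show ?thesis
      using finM fin by (auto simp: subsemigroups_of_index_def subsemigroup_def f_def)
  qed
  then have "f ` {V. V \<subseteq> B \<and> card V = j} \<subseteq> subsemigroups_of_index ?S (@) n" by blast
  moreover have "inj_on f {V. V \<subseteq> B \<and> card V = j}"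
  proof (rule inj_onI)
    fix U V assume "U \<in> {V. V \<subseteq> B \<and> card V = j}" "V \<in> {V. V \<subseteq> B \<and> card V = j}" "f U = f V"
    then show "U = V" using BS disj unfolding f_def by blast
  qed
  ultimately have "card {V. V \<subseteq> B \<and> card V = j} \<le> num_index ?S (@) n"
    unfolding num_index_def by (intro card_inj_on_le finite_subsemigroups_of_index)
  then have "r ^ (2 * k - 1) choose j \<le> num_index ?S (@) n"
    using n_subsets[OF finB] cardB by simp
  moreover have "n - r ^ k \<le> j" "j \<le> n" using cardM by (auto simp: j_def)
  ultimately show thesis using that by blast
qed

text \<open>For \<open>r ^ k\<close> just below \<open>n / 2\<close>, the number \<open>N\<close> of
  available words is at least \<open>n ^ 2 / (4 * r ^ 3)\<close>, hence at least
  \<open>n * sqrt n\<close> for large \<open>n\<close>. Choosing \<open>j\<close> of them gives at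
  least \<open>(N / j) ^ j\<close>, which is at least \<open>sqrt n ^ j\<close>. The square root and
  \<open>j \<ge> n / 2\<close> each contribute a factor 1/2 to the 1/4.\<close>

lemma subsemigroup_growth_lower:
  assumes r: "r \<ge> 2" and n: "n \<ge> 16 * r ^ 6"
  shows "real n * log 2 (real n) / 4 \<le> log 2 (real (subsemigroup_growth (free_semigroup r) (@) n))"
proof -
  have r6: "r ^ 6 \<ge> r" using r by (intro self_le_power) auto
  have nr: "n \<ge> 16 * r" using n r6 by linarith
  have "1 \<le> n div 2" using nr r by linarith
  then obtain k where k: "r ^ k \<le> n div 2" "n div 2 < r ^ (k + 1)"
    using ex_power_ivl1[OF r] by blast
  have "k \<noteq> 0" using k(2) nr r by (intro notI) auto
  then have k1: "k \<ge> 1" by simp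
  from k have kn: "r ^ k \<le> n" by linarith
  obtain j where j: "n - r ^ k \<le> j" "j \<le> n"
      "r ^ (2 * k - 1) choose j \<le> num_index (free_semigroup r) (@) n"
    using num_index_lower[OF r k1 kn] .
  define N where "N = real (r ^ (2 * k - 1))"
  have j2: "real j \<ge> real n / 2" using j(1) k(1) kn by linarith
  have npos: "real n \<ge> 1" "real j > 0" using nr r j2 by linarith+
  have "real n \<le> 2 * real (r ^ (k + 1))"
    using k(2) by linarith
  then have "real n ^ 2 \<le> (2 * real (r ^ (k + 1))) ^ 2" by (intro power_mono) auto
  also have "\<dots> = 4 * real r ^ (3 + (2 * k - 1))"
  proof -
    have "3 + (2 * k - 1) = (k + 1) * 2" using k1 by simp
    then show ?thesis by (simp only: power_mult power_mult_distrib of_nat_power) simp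
  qed
  also have "\<dots> = 4 * real r ^ 3 * N" by (simp add: N_def power_add)
  finally have nN: "real n ^ 2 \<le> 4 * real r ^ 3 * N" .
  \<comment> \<open>This is the origin of the threshold: \<open>16 * r ^ 6\<close> is the square of
    \<open>4 * r ^ 3\<close>.\<close>
  have "(4 * real r ^ 3) ^ 2 \<le> real n"
  proof -
    have "real (16 * r ^ 6) \<le> real n" using n by (simp only: of_nat_le_iff)
    then show ?thesis by (simp add: power_mult_distrib flip: power_mult)
  qed
  then have c: "4 * real r ^ 3 \<le> sqrt (real n)" by (rule real_le_rsqrt)
  have "real n * real n \<le> sqrt (real n) * N"
    using nN mult_right_mono[OF c, of N] by (simp add: N_def power2_eq_square)
  then have "sqrt (real n) * (sqrt (real n) * real n) \<le> sqrt (real n) * N"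
    by (simp flip: mult.assoc)
  then have sN: "sqrt (real n) * real n \<le> N"
    using npos by (simp only: mult_le_cancel_left_pos real_sqrt_gt_0_iff)
  have "sqrt (real n) * real j \<le> N"
    using sN j(2) by (meson mult_left_mono of_nat_le_iff order_trans real_sqrt_ge_zero of_nat_0_le_iff)
  then have ratio: "sqrt (real n) \<le> N / real j" using npos by (simp add: field_simps)
  have "1 \<le> sqrt (real n)" using npos by simp
  with ratio have "1 \<le> N / real j" by linarith
  then have "real j \<le> N" using npos by (simp add: field_simps)
  then have jN: "j \<le> r ^ (2 * k - 1)" unfolding N_def by linarith
  have "sqrt (real n) ^ j \<le> (N / real j) ^ j"
    using ratio by (intro power_mono) auto
  also have "\<dots> \<le> real (r ^ (2 * k - 1) choose j)"
    using binomial_ge_n_over_k_pow_k[OF jN, where ?'a = real] by (simp add: N_def)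
  also have "\<dots> \<le> real (num_index (free_semigroup r) (@) n)" using j(3) by linarith
  also have "\<dots> \<le> real (subsemigroup_growth (free_semigroup r) (@) n)"
    unfolding subsemigroup_growth_def of_nat_le_iff
    using npos by (intro member_le_sum) auto
  finally have le: "sqrt (real n) ^ j \<le> real (subsemigroup_growth (free_semigroup r) (@) n)" .
  have "real n * log 2 (real n) / 4 = real n / 2 * (log 2 (real n) / 2)" by simp
  also have "\<dots> \<le> real j * (log 2 (real n) / 2)"
    using j2 npos by (intro mult_right_mono) auto
  also have "\<dots> = log 2 (sqrt (real n) ^ j)"
    using npos by (simp add: log_nat_power log_powr sqrt_def log_root)
  also have "\<dots> \<le> log 2 (real (subsemigroup_growth (free_semigroup r) (@) n))"
    using le npos by (intro log_mono) auto
  finally show ?thesis .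
qed

section \<open>Combination of the two bounds\<close>

theorem corollary4p8:
  fixes r :: nat
  assumes "r \<ge> 2"
  shows "has_growth_of_strict_type (free_semigroup r) (@) (\<lambda>n. real n ^ n)"
proof -
  let ?g = "\<lambda>n. real (subsemigroup_growth (free_semigroup r) (@) n)"
  have bounds: "real n * log 2 (real n) / 4 \<le> log 2 (?g n) \<and> log 2 (?g n) \<le> 4 * (real n * log 2 (real n))
      \<and> 0 \<le> real n * log 2 (real n) \<and> log 2 (real n ^ n) = real n * log 2 (real n)"
    if n: "n \<ge> 16 * r ^ 6" for n
  proof -
    have "r ^ 6 \<ge> r" using assms by (intro self_le_power) auto
    with n assms have nr: "n \<ge> r + 1" by linarith
    then have npos: "real n \<ge> 1" by linarith
    let ?l = "log 2 (real n)"
    have l: "?l \<ge> 0" using npos by simp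
    have lower: "real n * ?l / 4 \<le> log 2 (?g n)"
      by (rule subsemigroup_growth_lower[OF assms n])
    \<comment> \<open>Monotonicity of the logarithm needs a positive argument; a zero count is
      separate, with \<open>log 2 0 = 0\<close> by convention. Otherwise \<open>n\<close> absorbs
      \<open>r + 1\<close>, and the exponent \<open>1 + 3 * n\<close> is at most
      \<open>4 * n\<close>.\<close>
    have "log 2 (?g n) \<le> 4 * (real n * ?l)"
    proof (cases "?g n = 0")
      case False
      have "subsemigroup_growth (free_semigroup r) (@) n \<le> n * ((r + 1) * n\<^sup>2) ^ n"
        by (rule subsemigroup_growth_upper)
      also have "\<dots> \<le> n * (n * n\<^sup>2) ^ n"
        using nr by (intro mult_le_mono power_mono) auto
      also have "\<dots> = n ^ (1 + 3 * n)"
        by (simp add: power_mult power3_eq_cube power2_eq_square mult.assoc)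
      finally have "?g n \<le> real n ^ (1 + 3 * n)"
        by (metis of_nat_le_iff of_nat_power)
      then have "log 2 (?g n) \<le> log 2 (real n ^ (1 + 3 * n))"
        using False npos by (subst log_le_cancel_iff) auto
      also have "\<dots> = (1 + 3 * real n) * ?l" using npos by (subst log_nat_power) auto
      also have "\<dots> \<le> (4 * real n) * ?l" using npos l by (intro mult_right_mono) auto
      finally show ?thesis by simp
    next
      case True
      then have "log 2 (?g n) = 0" by (simp add: log_def)
      then show ?thesis using l by simp
    qed
    moreover have "log 2 (real n ^ n) = real n * ?l" using npos by (simp add: log_nat_power)
    ultimately show ?thesis using lower l by simp
  qed
  have ev: "eventually (\<lambda>n. n \<ge> 16 * r ^ 6) sequentially" by (rule eventually_ge_at_top)
  \<comment> \<open>The constant 4 serves in both directions; nonnegativity in \<open>bounds\<close>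
    removes the norms.\<close>
  have "(\<lambda>n. log 2 (?g n)) \<in> O(\<lambda>n. log 2 (real n ^ n))"
    using ev by (intro bigoI[of _ 4]; eventually_elim) (use bounds in fastforce)
  moreover have "(\<lambda>n. log 2 (real n ^ n)) \<in> O(\<lambda>n. log 2 (?g n))"
    using ev by (intro bigoI[of _ 4]; eventually_elim) (use bounds in fastforce)
  ultimately show ?thesis
    unfolding has_growth_of_strict_type_def
    by (simp add: bigtheta_def bigomega_iff_bigo)
qed

end
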